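(* Let $\mu>0$, $p>1$, $r_0>0$, and let $u$ and $v$ be two positive radial functions in $C^2(B_{r_0}\setminus\{0\})$ satisfying $$\mathcal{M}^+(D^2u)+\mu\frac{u}{r^2}-u^p\ \ge\ 0\ \ge\ \mathcal{M}^+(D^2v)+\mu\frac{v}{r^2}-v^p\quad\text{in } B_{r_0}\setminus\{0\}.$$ Assume that $u,v\in C(\overline{B_{r_0}}\setminus\{0\})$ and that there exist positive constants $c_1,c_2$ such that $$c_1 r^{-\frac{2}{p-1}}\le v(r)\quad\text{and}\quad u(r),\,v(r)\le c_2 r^{-\frac{2}{p-1}}\quad\text{for } 0<r\le r_0.$$ If $u(r_0)\le v(r_0)$, then $u\le v$ in $\overline{B_{r_0}}\setminus\{0\}$.
   Context: Let $N$ be the space dimension, $0<\lambda\le\Lambda$, and for a symmetric $N\times N$ matrix $M$ with eigenvalues $\mu_1,\dots,\mu_N$ let $\mathcal{M}^+(M)=\Lambda\sum_{\mu_i>0}\mu_i+\lambda\sum_{\mu_i<0}\mu_i$ (Pucci's sup-operator). $B_{r_0}$ is the open ball of $\mathbb{R}^N$ of radius $r_0$ centered at the origin, $r=|x|$, and a radial function is written $u(x)=u(|x|)=u(r)$. *)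

theory Defs
  imports "HOL-Analysis.Analysis" "HOL-Computational_Algebra.Polynomial"
begin

definition charpoly :: "real ^ 'n ^ 'n \<Rightarrow> real poly" where
  "charpoly M = det (mat [:0, 1:] - (\<chi> i j. [:M $ i $ j:]))"

text \<open>The multiset of real eigenvalues, with algebraic multiplicity. For a symmetric matrix
  it has exactly \<open>CARD('n)\<close> elements; only symmetric matrices are of interest here.\<close>

definition eigvals :: "real ^ 'n ^ 'n \<Rightarrow> real multiset" where
  "eigvals M = proots (charpoly M)"

definition pucci_sup :: "real \<Rightarrow> real \<Rightarrow> real ^ 'n ^ 'n \<Rightarrow> real" where
  "pucci_sup lam Lam M =
     Lam * sum_mset (filter_mset (\<lambda>e. e > 0) (eigvals M))
     + lam * sum_mset (filter_mset (\<lambda>e. e < 0) (eigvals M))"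

definition pderivative :: "'n \<Rightarrow> (real ^ 'n \<Rightarrow> real) \<Rightarrow> real ^ 'n \<Rightarrow> real" where
  "pderivative i f x = frechet_derivative f (at x) (axis i 1)"

definition hessian :: "(real ^ 'n \<Rightarrow> real) \<Rightarrow> real ^ 'n \<Rightarrow> real ^ 'n ^ 'n" where
  "hessian f x = (\<chi> i j. pderivative i (pderivative j f) x)"

text \<open>Meant for open \<open>S\<close>: derivatives are taken at \<open>x\<close> in the full space. Continuity of \<open>f\<close>
  and of its first partial derivatives follows from differentiability.\<close>

definition C2_on :: "(real ^ 'n) set \<Rightarrow> (real ^ 'n \<Rightarrow> real) \<Rightarrow> bool" where
  "C2_on S f \<longleftrightarrow>
     (\<forall>x\<in>S. f differentiable (at x)) \<and>
     (\<forall>i. \<forall>x\<in>S. pderivative i f differentiable (at x)) \<and>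
     (\<forall>i j. continuous_on S (pderivative i (pderivative j f)))"

end

theory Submission
  imports Defs
begin

text \<open>At a point of a coordinate axis the Hessian of a radial function is
  diagonal with entries \<open>U'' r\<close> and \<open>U' r / r\<close>, so the claim becomes one about ordinary differential
  inequalities. Put \<open>\<alpha> = 2 / (p - 1)\<close>. Since \<open>p > 1\<close>, a multiple \<open>k v\<close> with \<open>k > 1\<close> is a strict
  supersolution, with a gap of at least \<open>(k powr p - k) c1 powr p\<close> at the scale \<open>r powr (-\<alpha> - 2)\<close>.
  Suppose \<open>\<kappa> = sup (u / v) > 1\<close> and take \<open>1 < k < \<kappa>\<close>. The function \<open>r powr \<alpha> (u - k v)\<close> is bounded above;
  it need not attain its supremum, but after subtracting \<open>e ln (r0 / r)\<close> it does, in the interior. There \<open>u\<close> is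
  touched from above by \<open>k v + r powr (-\<alpha>) (e ln (r0 / r) + C)\<close>, and comparing the two inequalities
  bounds the gap by a constant times \<open>m + e\<close>, where \<open>m = r powr \<alpha> (u - k v) \<le> (\<kappa> - k) c2\<close>. Letting \<open>k \<rightarrow> \<kappa>\<close> and \<open>e \<rightarrow> 0\<close> gives
  a contradiction. Subtracting the penalty from \<open>r powr \<alpha> (u - k v)\<close> rather than from \<open>u / v\<close>
  means that no bound on the derivative of \<open>v\<close> is needed.\<close>

section \<open>The Pucci operator on diagonal matrices\<close>

lemma proots_prod_linear:
  fixes d :: "'a \<Rightarrow> 'b :: idom"
  assumes "finite A"
  shows "proots (\<Prod>i\<in>A. [:- d i, 1:]) = image_mset d (mset_set A)"
  using assms
proof (induction A rule: finite_induct)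
  case (insert a A)
  have "(\<Prod>i\<in>A. [:- d i, 1:]) \<noteq> 0"
    by (simp add: insert.hyps)
  with insert show ?case
    by (simp add: proots_mult del: mult_pCons_left)
qed simp

text \<open>For a diagonal matrix the determinant defining \<open>charpoly\<close> is a product of
  linear factors, whose roots can be read off with multiplicity.\<close>

lemma eigvals_diagonal:
  fixes M :: "real ^ 'n ^ 'n"
  assumes "\<And>i j. i \<noteq> j \<Longrightarrow> M $ i $ j = 0"
  shows "eigvals M = image_mset (\<lambda>i. M $ i $ i) (mset_set UNIV)"
proof -
  have "charpoly M = (\<Prod>i\<in>UNIV. [:- (M $ i $ i), 1:])"
    unfolding charpoly_def using assms
    by (subst det_diagonal) (auto simp: mat_def)
  then show ?thesis
    by (simp add: eigvals_def proots_prod_linear)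
qed

text \<open>The Pucci operator in dimension one. As \<open>lam \<le> Lam\<close>, the case split on
  the sign of \<open>e\<close> is a maximum, a form that makes subadditivity and positive
  homogeneity immediate.\<close>

definition pucci_scalar :: "real \<Rightarrow> real \<Rightarrow> real \<Rightarrow> real" where
  "pucci_scalar lam Lam e = max (Lam * e) (lam * e)"

lemma pucci_sup_diagonal:
  fixes M :: "real ^ 'n ^ 'n"
  assumes "lam \<le> Lam" and "\<And>i j. i \<noteq> j \<Longrightarrow> M $ i $ j = 0"
  shows "pucci_sup lam Lam M = (\<Sum>i\<in>UNIV. pucci_scalar lam Lam (M $ i $ i))"
proof -
  have "Lam * sum_mset (filter_mset (\<lambda>e. e > 0) X) + lam * sum_mset (filter_mset (\<lambda>e. e < 0) X)
      = sum_mset (image_mset (pucci_scalar lam Lam) X)" for X :: "real multiset"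
  proof (induction X)
    case (add e X)
    have "pucci_scalar lam Lam e = (if e > 0 then Lam * e else lam * e)"
      using assms(1) by (auto simp: pucci_scalar_def max_def mult_le_cancel_right)
    with add show ?case by (auto simp: algebra_simps)
  qed simp
  then show ?thesis
    by (simp add: pucci_sup_def eigvals_diagonal[OF assms(2)] image_mset.compositionality o_def
        sum_unfold_sum_mset)
qed

lemma pucci_scalar_mono:
  assumes "0 < lam" "lam \<le> Lam" "a \<le> b"
  shows "pucci_scalar lam Lam a \<le> pucci_scalar lam Lam b"
  unfolding pucci_scalar_def using assms by (intro max.mono mult_left_mono) auto

lemma pucci_scalar_add: "pucci_scalar lam Lam (a + b) \<le> pucci_scalar lam Lam a + pucci_scalar lam Lam b"
  by (auto simp: pucci_scalar_def distrib_left max_def)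

lemma pucci_scalar_mult: "0 \<le> k \<Longrightarrow> pucci_scalar lam Lam (k * a) = k * pucci_scalar lam Lam a"
  by (simp add: pucci_scalar_def max_mult_distrib_left mult.left_commute)

lemma pucci_scalar_le_abs:
  assumes "0 < lam" "lam \<le> Lam"
  shows "pucci_scalar lam Lam a \<le> Lam * \<bar>a\<bar>"
proof -
  have "Lam * a \<le> Lam * \<bar>a\<bar>" "lam * a \<le> lam * \<bar>a\<bar>" "lam * \<bar>a\<bar> \<le> Lam * \<bar>a\<bar>"
    using assms by (auto intro: mult_left_mono mult_right_mono)
  then show ?thesis by (auto simp: pucci_scalar_def)
qed

section \<open>Derivatives of radial functions\<close>

lemma has_derivative_imp_pderivative:
  "(f has_derivative f') (at x) \<Longrightarrow> pderivative i f x = f' (axis i 1)"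
  unfolding pderivative_def by (metis frechet_derivative_at)

lemma pderivative_cong_open:
  assumes "open S" "x \<in> S" "\<And>y. y \<in> S \<Longrightarrow> f y = g y"
  shows "pderivative i f x = pderivative i g x"
proof -
  \<comment> \<open>\<open>frechet_derivative\<close> is a choice from the possible derivatives, so
    it suffices that \<open>f\<close> and \<open>g\<close> have the same ones; this covers points
    without differentiability too.\<close>
  have "(f has_derivative f') (at x) \<longleftrightarrow> (g has_derivative f') (at x)" for f'
    using assms by (metis has_derivative_transform_within_open)
  then show ?thesis
    by (simp add: pderivative_def frechet_derivative_def)
qed

lemma has_real_derivative_along_axis:
  fixes f :: "real ^ 'n \<Rightarrow> real"
  assumes "f differentiable (at (r *\<^sub>R axis k 1))"
  shows "((\<lambda>s. f (s *\<^sub>R axis k 1)) has_real_derivative pderivative k f (r *\<^sub>R axis k 1)) (at r)"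
proof -
  let ?D = "frechet_derivative f (at (r *\<^sub>R axis k 1))"
  have D: "(f has_derivative ?D) (at (r *\<^sub>R axis k 1))"
    using assms by (simp add: frechet_derivative_works)
  have "((\<lambda>s. f (s *\<^sub>R axis k 1)) has_derivative (\<lambda>h. ?D (h *\<^sub>R axis k 1))) (at r)"
    by (rule has_derivative_compose[where f = "\<lambda>s. s *\<^sub>R axis k 1", OF _ D]) (auto intro!: derivative_eq_intros)
  moreover have "?D (h *\<^sub>R axis k 1) = pderivative k f (r *\<^sub>R axis k 1) * h" for h
    using linear_cmul[OF has_derivative_linear[OF D]] by (simp add: pderivative_def)
  ultimately show ?thesis
    by (simp add: has_field_derivative_def)
qed

lemma has_derivative_radial:
  fixes x :: "'a :: real_inner"
  assumes "x \<noteq> 0" "(g has_real_derivative g') (at (norm x))"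
  shows "((\<lambda>y. g (norm y)) has_derivative (\<lambda>h. g' * (h \<bullet> x / norm x))) (at x)"
proof -
  have "(norm has_derivative (\<lambda>h. h \<bullet> x / norm x)) (at x)"
    using has_derivative_norm[of x] assms(1)
    by (simp add: inner_commute sgn_div_norm divide_inverse mult.commute)
  from has_derivative_compose[OF this assms(2)[unfolded has_field_derivative_def]]
  show ?thesis .
qed

lemma pderivative_radial:
  fixes x :: "real ^ 'n"
  assumes "x \<noteq> 0" "(g has_real_derivative g') (at (norm x))"
  shows "pderivative i (\<lambda>y. g (norm y)) x = g' / norm x * x $ i"
  using has_derivative_imp_pderivative[OF has_derivative_radial[OF assms], of i]
  by (simp add: inner_axis')

text \<open>Meant for \<open>g s = U1 s / s\<close>: the components of a radial gradient have this
  form, so this rule yields the Hessian.\<close>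

lemma pderivative_radial_mult_component:
  fixes x :: "real ^ 'n"
  assumes "x \<noteq> 0" "(g has_real_derivative g') (at (norm x))"
  shows "pderivative i (\<lambda>y. g (norm y) * y $ j) x
           = g' * (x $ i / norm x) * x $ j + g (norm x) * (if i = j then 1 else 0)"
proof -
  have "((\<lambda>y. y $ j) has_derivative (\<lambda>h. h $ j)) (at x)"
    by (rule bounded_linear_imp_has_derivative[OF bounded_linear_vec_nth])
  from has_derivative_imp_pderivative[OF has_derivative_mult[OF has_derivative_radial[OF assms] this], of i]
  show ?thesis
    by (simp add: inner_axis') (simp add: axis_def)
qed

text \<open>The profile inherits its derivatives from \<open>u\<close> restricted to the
  \<open>k\<close>-th axis: \<open>U1\<close> and \<open>U2\<close> are the pure partial derivatives
  of \<open>u\<close> there. The Hessian then follows by differentiating the gradient formula, valid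
  on an open set, once more.\<close>

lemma radial_C2:
  fixes u :: "real ^ 'n \<Rightarrow> real" and k :: 'n
  assumes C2: "C2_on (ball 0 R - {0}) u"
    and rad: "\<And>x. x \<in> ball 0 R - {0} \<Longrightarrow> u x = U (norm x)"
  obtains U1 U2 where
    "\<And>r. 0 < r \<Longrightarrow> r < R \<Longrightarrow> (U has_real_derivative U1 r) (at r)"
    "\<And>r. 0 < r \<Longrightarrow> r < R \<Longrightarrow> (U1 has_real_derivative U2 r) (at r)"
    "\<And>r i j. 0 < r \<Longrightarrow> r < R \<Longrightarrow> hessian u (r *\<^sub>R axis k 1) $ i $ j
       = (if i \<noteq> j then 0 else if i = k then U2 r else U1 r / r)"
proof
  define S where "S = ball (0 :: real ^ 'n) R - {0}"
  define U1 where "U1 = (\<lambda>r. pderivative k u (r *\<^sub>R axis k 1))"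
  define U2 where "U2 = (\<lambda>r. pderivative k (pderivative k u) (r *\<^sub>R axis k 1))"
  have S: "open S" by (auto simp: S_def)
  have axis: "axis k (1 :: real) $ i = (if i = k then 1 else 0)" for i
    by (simp add: axis_def)
  have axis_in: "r *\<^sub>R axis k 1 \<in> S" if "0 < r" "r < R" for r
    using that by (auto simp: S_def axis_eq_0_iff)
  show U1: "(U has_real_derivative U1 r) (at r)" if r: "0 < r" "r < R" for r
  proof -
    have "((\<lambda>s. u (s *\<^sub>R axis k 1)) has_real_derivative U1 r) (at r)"
      unfolding U1_def using C2 axis_in[OF r]
      by (intro has_real_derivative_along_axis) (auto simp: C2_on_def S_def)
    then show ?thesis
    proof (rule has_field_derivative_transform_within_open)
      show "open {0<..<R}" "r \<in> {0<..<R}" using r by auto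
      show "u (s *\<^sub>R axis k 1) = U s" if "s \<in> {0<..<R}" for s
        using rad[of "s *\<^sub>R axis k 1"] axis_in[of s] that by (auto simp: S_def)
    qed
  qed
  show U2: "(U1 has_real_derivative U2 r) (at r)" if r: "0 < r" "r < R" for r
    unfolding U1_def U2_def using C2 axis_in[OF r]
    by (intro has_real_derivative_along_axis) (auto simp: C2_on_def S_def)
  have pd: "pderivative j u y = U1 (norm y) / norm y * y $ j" if y: "y \<in> S" for y j
  proof -
    have "pderivative j u y = pderivative j (\<lambda>y. U (norm y)) y"
      by (rule pderivative_cong_open[OF S y]) (use rad in \<open>auto simp: S_def\<close>)
    also have "\<dots> = U1 (norm y) / norm y * y $ j"
      by (rule pderivative_radial) (use y U1 in \<open>auto simp: S_def\<close>)
    finally show ?thesis .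
  qed
  show "hessian u (r *\<^sub>R axis k 1) $ i $ j
       = (if i \<noteq> j then 0 else if i = k then U2 r else U1 r / r)"
    if r: "0 < r" "r < R" for r i j
  proof -
    \<comment> \<open>In the entry \<open>i = j = k\<close> this derivative times \<open>r\<close>,
      plus \<open>U1 r / r\<close>, collapses to \<open>U2 r\<close>; in the other diagonal entries
      only \<open>U1 r / r\<close> survives.\<close>
    have g: "((\<lambda>s. U1 s / s) has_real_derivative (U2 r * r - U1 r) / (r * r)) (at r)"
      using U2[OF r] r by (auto intro!: derivative_eq_intros)
    have "hessian u (r *\<^sub>R axis k 1) $ i $ j = pderivative i (pderivative j u) (r *\<^sub>R axis k 1)"
      by (simp add: hessian_def)
    also have "\<dots> = pderivative i (\<lambda>y. U1 (norm y) / norm y * y $ j) (r *\<^sub>R axis k 1)"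
      using pd by (intro pderivative_cong_open[OF S axis_in[OF r]]) auto
    also have "\<dots> = (if i \<noteq> j then 0 else if i = k then U2 r else U1 r / r)"
      using r g axis
      by (subst pderivative_radial_mult_component[where g = "\<lambda>s. U1 s / s"
            and g' = "(U2 r * r - U1 r) / (r * r)"])
        (auto simp: axis_eq_0_iff field_simps)
    finally show ?thesis .
  qed
qed

lemma pucci_sup_hessian_radial:
  fixes u :: "real ^ 'n \<Rightarrow> real"
  assumes "lam \<le> Lam"
    and "\<And>i j. hessian u x $ i $ j = (if i \<noteq> j then 0 else if i = k then a else b)"
  shows "pucci_sup lam Lam (hessian u x)
    = pucci_scalar lam Lam a + real (CARD('n) - 1) * pucci_scalar lam Lam b"
proof -
  have "pucci_sup lam Lam (hessian u x) = (\<Sum>i\<in>UNIV. pucci_scalar lam Lam (if i = k then a else b))"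
    using assms by (subst pucci_sup_diagonal) auto
  also have "\<dots> = pucci_scalar lam Lam a + (\<Sum>i\<in>UNIV-{k}. pucci_scalar lam Lam b)"
    by (subst sum.remove[of _ k]) (auto intro!: sum.cong)
  finally show ?thesis by simp
qed

section \<open>Conditions at an interior maximum, the barrier, and the touching point\<close>

lemma second_derivative_local_max:
  fixes w :: "real \<Rightarrow> real"
  assumes "a < r" "r < b"
    and d1: "\<And>s. a < s \<Longrightarrow> s < b \<Longrightarrow> (w has_real_derivative w1 s) (at s)"
    and d2: "(w1 has_real_derivative w2) (at r)"
    and mx: "\<And>s. a < s \<Longrightarrow> s < b \<Longrightarrow> w s \<le> w r"
  shows "w1 r = 0" "w2 \<le> 0"
proof -
  show 0: "w1 r = 0"
  proof (rule DERIV_local_max[OF d1])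
    show "0 < min (r - a) (b - r)" using assms by auto
    show "\<forall>y. \<bar>r - y\<bar> < min (r - a) (b - r) \<longrightarrow> w y \<le> w r" using mx by auto
  qed (use assms in auto)
  show "w2 \<le> 0"
  proof (rule ccontr)
    \<comment> \<open>A positive derivative of \<open>w1\<close> at its zero \<open>r\<close> makes
      \<open>w1\<close> positive just to the right, so \<open>w\<close> would increase beyond its
      maximum.\<close>
    assume "\<not> w2 \<le> 0"
    then obtain d where d: "d > 0" "\<And>h. 0 < h \<Longrightarrow> h < d \<Longrightarrow> w1 r < w1 (r + h)"
      using DERIV_pos_inc_right[OF d2] by auto
    define s where "s = r + min d (b - r) / 2"
    have s: "r < s" "s < b" "s < r + d"
      using assms d by (auto simp: s_def min_def field_simps)
    have "w r < w s"
    proof (rule DERIV_pos_imp_increasing_open[OF s(1)])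
      show "\<exists>y. (w has_real_derivative y) (at x) \<and> 0 < y" if "r < x" "x < s" for x
        using d1[of x] d(2)[of "x - r"] 0 that s assms(1) by auto
      show "continuous_on {r..s} w"
        using d1 s assms(1) by (intro continuous_at_imp_continuous_on ballI DERIV_isCont[OF d1]) auto
    qed
    moreover have "w s \<le> w r" using mx[of s] s assms(1) by linarith
    ultimately show False by simp
  qed
qed

lemma barrier_derivatives:
  fixes r r0 e C \<alpha> :: real
  assumes "0 < r" "0 < r0"
  shows "((\<lambda>s. s powr (-\<alpha>) * (e * ln (r0 / s) + C)) has_real_derivative
           r powr (-\<alpha> - 1) * (- \<alpha> * (e * ln (r0 / r) + C) - e)) (at r)"
    and "((\<lambda>s. s powr (-\<alpha> - 1) * (- \<alpha> * (e * ln (r0 / s) + C) - e)) has_real_derivative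
           r powr (-\<alpha> - 2) * ((\<alpha> + 1) * (\<alpha> * (e * ln (r0 / r) + C) + e) + \<alpha> * e)) (at r)"
proof -
  have ln: "((\<lambda>s. ln (r0 / s)) has_real_derivative - 1 / r) (at r)"
    using assms by (auto intro!: derivative_eq_intros simp: field_simps)
  have pw: "((\<lambda>s. s powr b) has_real_derivative b * r powr (b - 1)) (at r)" for b
    using assms by (auto intro!: derivative_eq_intros)
  have shift: "r powr b * (x / r) = r powr (b - 1) * x" for b x
    using assms by (simp add: powr_diff)
  show "((\<lambda>s. s powr (-\<alpha>) * (e * ln (r0 / s) + C)) has_real_derivative
           r powr (-\<alpha> - 1) * (- \<alpha> * (e * ln (r0 / r) + C) - e)) (at r)"
    by (rule derivative_eq_intros refl ln pw)+
      (use shift[of "-\<alpha>" e] in \<open>simp add: algebra_simps\<close>)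
  show "((\<lambda>s. s powr (-\<alpha> - 1) * (- \<alpha> * (e * ln (r0 / s) + C) - e)) has_real_derivative
           r powr (-\<alpha> - 2) * ((\<alpha> + 1) * (\<alpha> * (e * ln (r0 / r) + C) + e) + \<alpha> * e)) (at r)"
    by (rule derivative_eq_intros refl ln pw)+
      (use shift[of "-\<alpha>-1" "\<alpha> * e"] in \<open>simp add: algebra_simps\<close>)
qed

text \<open>Here \<open>m\<close> is the barrier multiplied by \<open>r powr \<alpha>\<close>, and
  \<open>a\<close>, \<open>b\<close> are the second and first derivatives of \<open>U\<close>.
  Monotonicity and subadditivity of \<open>pucci_scalar\<close> split off the supersolution
  inequality times \<open>k\<close>; the remaining terms all scale like \<open>q\<close>, which
  cancels.\<close>

lemma touching_inequality:
  fixes a b a' b' x1 x2 r U V m e q \<alpha> n :: real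
  assumes lam: "0 < lam" "lam \<le> Lam" and mu: "mu > 0" and p: "p > 1" and n: "n \<ge> 0"
    and r: "r > 0" and q: "q = r powr (-\<alpha> - 2)" and \<alpha>: "\<alpha> = 2 / (p - 1)"
    and me: "m \<ge> 0" "e \<ge> 0" and k: "k > 1" and c1: "c1 > 0"
    and V: "c1 * r powr (- \<alpha>) \<le> V"
    and U: "U = k * V + r powr (-\<alpha>) * m"
    and b: "b = k * b' + r powr (-\<alpha> - 1) * (- \<alpha> * m - e)"
    and a: "a \<le> k * a' + q * ((\<alpha> + 1) * (\<alpha> * m + e) + \<alpha> * e)"
    and sub: "pucci_scalar lam Lam a + n * pucci_scalar lam Lam (b / r) + mu * U / r\<^sup>2 - U powr p \<ge> 0"
    and super: "0 \<ge> pucci_scalar lam Lam a' + n * pucci_scalar lam Lam (b' / r) + mu * V / r\<^sup>2 - V powr p"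
  shows "(k powr p - k) * c1 powr p \<le> (Lam * (1 + n) * ((\<alpha> + 1)\<^sup>2 + \<alpha>) + mu) * (m + e)"
proof -
  let ?f = "pucci_scalar lam Lam"
  let ?B = "((\<alpha> + 1)\<^sup>2 + \<alpha>) * (m + e)"
  have \<alpha>0: "\<alpha> > 0" using p by (simp add: \<alpha>)
  have q0: "q > 0" using r by (simp add: q)
  have qr: "r powr (-\<alpha> - 1) / r = q" "r powr (-\<alpha>) / r\<^sup>2 = q"
    using r by (simp_all add: q powr_diff power2_eq_square)
  have B: "?B \<ge> 0" using \<alpha>0 me by simp
  have V0: "V > 0" using V c1 r by (smt (verit) mult_pos_pos powr_gt_zero)
  \<comment> \<open>One constant dominates the barrier's contributions to both the second and the
    first derivative.\<close>
  have est2: "(\<alpha> + 1) * (\<alpha> * m + e) + \<alpha> * e \<le> ?B" and est1: "\<alpha> * m + e \<le> ?B"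
    using \<alpha>0 me by (auto simp: power2_eq_square algebra_simps)
  have "?f a \<le> ?f (k * a' + q * ((\<alpha> + 1) * (\<alpha> * m + e) + \<alpha> * e))"
    by (rule pucci_scalar_mono[OF lam a])
  also have "\<dots> \<le> k * ?f a' + ?f (q * ((\<alpha> + 1) * (\<alpha> * m + e) + \<alpha> * e))"
    using pucci_scalar_add pucci_scalar_mult k by (metis less_eq_real_def less_trans zero_less_one)
  also have "?f (q * ((\<alpha> + 1) * (\<alpha> * m + e) + \<alpha> * e)) \<le> Lam * (q * ?B)"
  proof (rule order_trans[OF pucci_scalar_le_abs[OF lam]] mult_left_mono)+
    show "\<bar>q * ((\<alpha> + 1) * (\<alpha> * m + e) + \<alpha> * e)\<bar> \<le> q * ?B"
      using est2 q0 \<alpha>0 me by (simp add: abs_mult)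
  qed (use lam in auto)
  finally have fa: "?f a \<le> k * ?f a' + Lam * (q * ?B)" by simp
  have "b / r = k * (b' / r) + q * (- \<alpha> * m - e)"
    by (simp add: b qr(1)[symmetric] add_divide_distrib)
  then have "?f (b / r) \<le> k * ?f (b' / r) + ?f (q * (- \<alpha> * m - e))"
    using pucci_scalar_add pucci_scalar_mult k by (metis less_eq_real_def less_trans zero_less_one)
  also have "?f (q * (- \<alpha> * m - e)) \<le> Lam * (q * ?B)"
  proof (rule order_trans[OF pucci_scalar_le_abs[OF lam]] mult_left_mono)+
    have "\<alpha> * m \<ge> 0" using \<alpha>0 me by simp
    then have "\<bar>- \<alpha> * m - e\<bar> = \<alpha> * m + e" using me by linarith
    then show "\<bar>q * (- \<alpha> * m - e)\<bar> \<le> q * ?B"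
      using est1 q0 by (simp add: abs_mult)
  qed (use lam in auto)
  finally have "n * ?f (b / r) \<le> n * (k * ?f (b' / r) + Lam * (q * ?B))"
    using n by (intro mult_left_mono) auto
  moreover have "mu * U / r\<^sup>2 \<le> k * (mu * V / r\<^sup>2) + q * (mu * (m + e))"
  proof -
    have "mu * U / r\<^sup>2 = k * (mu * V / r\<^sup>2) + q * (mu * m)"
      by (simp add: U qr(2)[symmetric] add_divide_distrib distrib_left mult_ac)
    moreover have "q * (mu * m) \<le> q * (mu * (m + e))"
      using q0 mu me by auto
    ultimately show ?thesis by simp
  qed
  \<comment> \<open>The sign of \<open>m\<close> enters here: \<open>U\<close> lies above
    \<open>k * V\<close>, so the absorption term of \<open>U\<close> is at least
    \<open>k powr p * V powr p\<close>, against only \<open>k * V powr p\<close> from the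
    supersolution.\<close>
  moreover have "(k * V) powr p \<le> U powr p"
    using V0 k p r me by (intro powr_mono2) (auto simp: U)
  moreover have "(k * V) powr p = k powr p * V powr p"
    using k V0 by (simp add: powr_mult)
  moreover have "k * (?f a' + n * ?f (b' / r) + mu * V / r\<^sup>2 - V powr p) \<le> 0"
    using super k by (simp add: mult_le_0_iff)
  ultimately have "(k powr p - k) * V powr p
      \<le> q * ((Lam * (1 + n) * ((\<alpha> + 1)\<^sup>2 + \<alpha>) + mu) * (m + e))"
    using fa sub by (simp add: algebra_simps)
  moreover have "(k powr p - k) * (c1 powr p * q) \<le> (k powr p - k) * V powr p"
  proof (rule mult_left_mono)
    \<comment> \<open>The choice of \<alpha> makes the power term scale exactly like the
      second-order terms.\<close>
    have "- \<alpha> - 2 = - \<alpha> * p" using p by (simp add: \<alpha> field_simps)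
    then have "c1 powr p * q = (c1 * r powr (- \<alpha>)) powr p"
      using c1 r by (simp add: q powr_mult powr_powr)
    also have "\<dots> \<le> V powr p" using V c1 p r by (intro powr_mono2) auto
    finally show "c1 powr p * q \<le> V powr p" .
    show "0 \<le> k powr p - k" using powr_mono[of 1 p k] k p by simp
  qed
  ultimately have "q * ((k powr p - k) * c1 powr p)
      \<le> q * ((Lam * (1 + n) * ((\<alpha> + 1)\<^sup>2 + \<alpha>) + mu) * (m + e))"
    by (simp add: mult_ac)
  then show ?thesis using q0 by (simp only: mult_le_cancel_left_pos)
qed

section \<open>Comparison of radial profiles\<close>

lemma radial_comparison:
  fixes U V U1 U2 V1 V2 :: "real \<Rightarrow> real" and n :: real
  assumes lam: "0 < lam" "lam \<le> Lam" and mu: "mu > 0" and p: "p > 1" and r0: "r0 > 0" and n: "n \<ge> 0"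
    and \<alpha>: "\<alpha> = 2 / (p - 1)"
    and dU: "\<And>r. 0 < r \<Longrightarrow> r < r0 \<Longrightarrow> (U has_real_derivative U1 r) (at r)"
            "\<And>r. 0 < r \<Longrightarrow> r < r0 \<Longrightarrow> (U1 has_real_derivative U2 r) (at r)"
    and dV: "\<And>r. 0 < r \<Longrightarrow> r < r0 \<Longrightarrow> (V has_real_derivative V1 r) (at r)"
            "\<And>r. 0 < r \<Longrightarrow> r < r0 \<Longrightarrow> (V1 has_real_derivative V2 r) (at r)"
    and sub: "\<And>r. 0 < r \<Longrightarrow> r < r0 \<Longrightarrow>
      pucci_scalar lam Lam (U2 r) + n * pucci_scalar lam Lam (U1 r / r)
        + mu * U r / r\<^sup>2 - U r powr p \<ge> 0"
    and super: "\<And>r. 0 < r \<Longrightarrow> r < r0 \<Longrightarrow>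
      0 \<ge> pucci_scalar lam Lam (V2 r) + n * pucci_scalar lam Lam (V1 r / r)
        + mu * V r / r\<^sup>2 - V r powr p"
    and contU: "continuous_on {0<..r0} U" and contV: "continuous_on {0<..r0} V"
    and c: "c1 > 0" "c2 > 0"
    and lower: "\<And>r. 0 < r \<Longrightarrow> r \<le> r0 \<Longrightarrow> c1 * r powr (- \<alpha>) \<le> V r"
    and upper: "\<And>r. 0 < r \<Longrightarrow> r \<le> r0 \<Longrightarrow> U r \<le> c2 * r powr (- \<alpha>)"
               "\<And>r. 0 < r \<Longrightarrow> r \<le> r0 \<Longrightarrow> V r \<le> c2 * r powr (- \<alpha>)"
    and bdry: "U r0 \<le> V r0"
    and r: "0 < r" "r \<le> r0"
  shows "U r \<le> V r"
proof (rule ccontr)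
  assume less: "\<not> U r \<le> V r"
  have \<alpha>0: "\<alpha> > 0" using p by (simp add: \<alpha>)
  have Vpos: "V s > 0" if "0 < s" "s \<le> r0" for s
    using lower[OF that] c that by (smt (verit) mult_pos_pos powr_gt_zero)
  define Q where "Q = (\<lambda>s. U s / V s) ` {0<..r0}"
  define \<kappa> where "\<kappa> = Sup Q"
  have Qne: "Q \<noteq> {}" using r0 by (auto simp: Q_def)
  have Qbdd: "bdd_above Q"
  proof (rule bdd_aboveI)
    fix x assume "x \<in> Q"
    then obtain s where s: "0 < s" "s \<le> r0" "x = U s / V s" by (auto simp: Q_def)
    have "c1 * U s \<le> c1 * (c2 * s powr (- \<alpha>))"
      using upper(1)[OF s(1,2)] c by (intro mult_left_mono) auto
    also have "\<dots> \<le> c2 * V s"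
      using mult_left_mono[OF lower[OF s(1,2)], of c2] c by (simp add: mult_ac)
    finally show "x \<le> c2 / c1"
      unfolding s(3) using c Vpos[OF s(1,2)] by (simp add: field_simps)
  qed
  have U_le: "U s \<le> \<kappa> * V s" if "0 < s" "s \<le> r0" for s
  proof -
    have "U s / V s \<le> \<kappa>"
      unfolding \<kappa>_def by (rule cSup_upper[OF _ Qbdd]) (use that in \<open>auto simp: Q_def\<close>)
    then show ?thesis using Vpos[OF that] by (simp add: field_simps)
  qed
  have "1 < \<kappa>"
    using U_le[OF r] less Vpos[OF r] by (smt (verit) mult_left_le_one_le mult_le_cancel_right1)
  \<comment> \<open>Fixing \<open>h\<close> strictly between 1 and \<kappa> gives a gap \<delta>
    that does not shrink as \<open>k\<close> approaches \<kappa>.\<close>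
  define h where "h = (1 + \<kappa>) / 2"
  have h: "1 < h" "h < \<kappa>" using \<open>1 < \<kappa>\<close> by (auto simp: h_def)
  define \<delta> where "\<delta> = (h powr p - h) * c1 powr p"
  define K where "K = Lam * (1 + n) * ((\<alpha> + 1)\<^sup>2 + \<alpha>) + mu"
  have \<delta>: "\<delta> > 0"
    using powr_less_mono[of 1 p h] h p c by (simp add: \<delta>_def)
  have K: "K > 0"
    unfolding K_def using lam n \<alpha>0 mu by (intro add_nonneg_pos mult_nonneg_nonneg) auto
  \<comment> \<open>The second entry places \<open>k\<close> so close to \<kappa> that the term
    \<open>K * m\<close> will cost at most half of \<delta>; the first keeps the gap for
    \<open>k\<close> at least \<delta>.\<close>
  define k where "k = max h (\<kappa> - \<delta> / (2 * K * c2))"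
  have k: "h \<le> k" "k < \<kappa>" "1 < k"
    using h \<delta> K c by (auto simp: k_def)
  have k_near: "K * ((\<kappa> - k) * c2) \<le> \<delta> / 2"
  proof -
    have "\<kappa> - k \<le> \<delta> / (2 * K * c2)" by (auto simp: k_def)
    then show ?thesis using K c by (simp add: field_simps)
  qed
  have \<delta>_le: "\<delta> \<le> (k powr p - k) * c1 powr p"
  proof -
    \<comment> \<open>For \<open>x > 1\<close> both factors are nonnegative and increasing in
      \<open>x\<close>, so the gap grows with \<open>k\<close>.\<close>
    have eq: "x powr p - x = x * (x powr (p - 1) - 1)" if "x > 1" for x
      using that powr_add[of x 1 "p - 1"] by (simp add: algebra_simps)
    have "h * (h powr (p - 1) - 1) \<le> k * (k powr (p - 1) - 1)"
      using h k p ge_one_powr_ge_zero[of h "p - 1"]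
      by (intro mult_mono diff_right_mono powr_mono2) auto
    then show ?thesis
      unfolding \<delta>_def using eq[of h] eq[of k] h k by (simp add: mult_right_mono)
  qed
  obtain s where s: "0 < s" "s \<le> r0" "k * V s < U s"
  proof -
    obtain x where "x \<in> Q" "k < x"
      using less_cSupE[OF k(2)[unfolded \<kappa>_def] Qne] by auto
    then obtain s where "0 < s" "s \<le> r0" "k < U s / V s" by (auto simp: Q_def)
    with that Vpos[of s] show ?thesis by (auto simp: field_simps)
  qed
  define gap where "gap = s powr \<alpha> * (U s - k * V s)"
  have gap: "gap > 0" using s by (simp add: gap_def)
  have ln0: "ln (r0 / t) \<ge> 0" if "0 < t" "t \<le> r0" for t
    using that by simp
  \<comment> \<open>The first bound makes \<open>K * e\<close> less than half of \<delta>, the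
    second keeps \<open>G s\<close> positive. The added 1 avoids a zero denominator when
    \<open>s = r0\<close>.\<close>
  define e where "e = min (\<delta> / (4 * K)) (gap / (ln (r0 / s) + 1))"
  have e: "e > 0" "K * e < \<delta> / 2" "e * ln (r0 / s) < gap"
  proof -
    show "e > 0" using \<delta> K gap ln0[OF s(1,2)] by (simp add: e_def)
    have "K * e \<le> K * (\<delta> / (4 * K))" using K by (intro mult_left_mono) (auto simp: e_def)
    then show "K * e < \<delta> / 2" using K \<delta> by simp
    have "e * (ln (r0 / s) + 1) \<le> gap / (ln (r0 / s) + 1) * (ln (r0 / s) + 1)"
      using ln0[OF s(1,2)] by (intro mult_right_mono) (auto simp: e_def)
    also have "\<dots> = gap" using ln0[OF s(1,2)] by simp
    finally show "e * ln (r0 / s) < gap" using \<open>e > 0\<close> by (simp add: algebra_simps)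
  qed
  define G where "G = (\<lambda>t. t powr \<alpha> * (U t - k * V t) - e * ln (r0 / t))"
  have Gs: "G s > 0" using e by (simp add: G_def gap_def)
  have scaled: "t powr \<alpha> * (U t - k * V t) \<le> (\<kappa> - k) * c2" if "0 < t" "t \<le> r0" for t
  proof -
    have "U t - k * V t \<le> (\<kappa> - k) * V t" using U_le[OF that] by (simp add: algebra_simps)
    also have "\<dots> \<le> (\<kappa> - k) * (c2 * t powr (- \<alpha>))"
      using upper(2)[OF that] k by (intro mult_left_mono) auto
    finally have "t powr \<alpha> * (U t - k * V t) \<le> t powr \<alpha> * ((\<kappa> - k) * (c2 * t powr (- \<alpha>)))"
      by (intro mult_left_mono) auto
    also have "\<dots> = (\<kappa> - k) * c2" using that by (simp add: powr_minus)
    finally show ?thesis .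
  qed
  \<comment> \<open>At the second radius the penalty equals the bound in \<open>scaled\<close>, so
    \<open>G\<close> is nonpositive from there inwards. The minimum with \<open>s\<close> keeps
    \<open>s\<close> in the compact interval.\<close>
  define t0 where "t0 = min s (r0 * exp (- ((\<kappa> - k) * c2 / e)))"
  have t0: "0 < t0" "t0 \<le> s" using s r0 by (auto simp: t0_def)
  have G_small: "G t \<le> 0" if t: "0 < t" "t \<le> t0" for t
  proof -
    have "t \<le> r0 * exp (- ((\<kappa> - k) * c2 / e))" using t by (auto simp: t0_def)
    then have "exp ((\<kappa> - k) * c2 / e) \<le> r0 / t"
      using t by (simp add: exp_minus field_simps)
    then have "(\<kappa> - k) * c2 / e \<le> ln (r0 / t)"
      using t r0 by (simp add: ln_ge_iff)
    then have "(\<kappa> - k) * c2 \<le> e * ln (r0 / t)" using e by (simp add: field_simps)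
    with scaled[of t] t t0 s show ?thesis by (simp add: G_def)
  qed
  have "continuous_on {t0..r0} G"
    unfolding G_def using t0 r0
    by (intro continuous_intros continuous_on_subset[OF contU] continuous_on_subset[OF contV]) auto
  then obtain r1 where r1: "t0 \<le> r1" "r1 \<le> r0" "\<And>t. t0 \<le> t \<Longrightarrow> t \<le> r0 \<Longrightarrow> G t \<le> G r1"
    using continuous_attains_sup[of "{t0..r0}" G] t0 s by auto
  have Gr1: "G r1 > 0" using r1(3)[of s] Gs t0 s by auto
  have G_le: "G t \<le> G r1" if "0 < t" "t \<le> r0" for t
    using r1(3)[of t] G_small[of t] Gr1 that by (cases "t \<le> t0") auto
  have r1_0: "0 < r1" using r1 t0 by auto
  \<comment> \<open>The penalty vanishes at \<open>r0\<close>, and the boundary inequality with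
    \<open>k > 1\<close> then keeps the positive maximum of \<open>G\<close> away from that
    endpoint.\<close>
  have "G r0 \<le> 0"
  proof -
    have "V r0 \<le> k * V r0" using Vpos[of r0] r0 k by simp
    then have "U r0 - k * V r0 \<le> 0" using bdry by simp
    then show ?thesis using r0 by (simp add: G_def mult_nonneg_nonpos)
  qed
  then have r1_r0: "r1 < r0" using Gr1 r1 by (cases "r1 = r0") auto
  \<comment> \<open>With this constant, \<open>k * V + \<psi>\<close> touches \<open>U\<close> from
    above at \<open>r1\<close>.\<close>
  define C where "C = G r1"
  define m where "m = e * ln (r0 / r1) + C"
  define \<psi> where "\<psi> = (\<lambda>t. t powr (- \<alpha>) * (e * ln (r0 / t) + C))"
  define \<psi>1 where "\<psi>1 = (\<lambda>t. t powr (- \<alpha> - 1) * (- \<alpha> * (e * ln (r0 / t) + C) - e))"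
  define \<psi>2 where "\<psi>2 = r1 powr (- \<alpha> - 2) * ((\<alpha> + 1) * (\<alpha> * m + e) + \<alpha> * e)"
  define w where "w = (\<lambda>t. U t - k * V t - \<psi> t)"
  \<comment> \<open>The weight is positive and \<open>G - C\<close> is nonpositive, vanishing at
    \<open>r1\<close>; hence the maximum of \<open>G\<close> is also one of \<open>w\<close>,
    despite the weight.\<close>
  have w: "w t = t powr (- \<alpha>) * (G t - C)" if "0 < t" for t
    using that by (simp add: w_def G_def \<psi>_def powr_minus field_simps)
  have wr1: "w r1 = 0" using w[OF r1_0] by (simp add: C_def)
  have w_le: "w t \<le> w r1" if "0 < t" "t < r0" for t
    using w[of t] wr1 G_le[of t] that by (simp add: C_def mult_nonneg_nonpos)
  have dw: "(w has_real_derivative (U1 t - k * V1 t - \<psi>1 t)) (at t)" if "0 < t" "t < r0" for t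
    unfolding w_def \<psi>_def \<psi>1_def
    by (rule derivative_eq_intros refl dU(1)[OF that] dV(1)[OF that]
        barrier_derivatives(1)[OF that(1) r0])+ simp
  have ddw: "((\<lambda>t. U1 t - k * V1 t - \<psi>1 t) has_real_derivative (U2 r1 - k * V2 r1 - \<psi>2)) (at r1)"
    unfolding \<psi>1_def \<psi>2_def m_def
    by (rule derivative_eq_intros refl dU(2)[OF r1_0 r1_r0] dV(2)[OF r1_0 r1_r0]
        barrier_derivatives(2)[OF r1_0 r0])+ simp
  note crit = second_derivative_local_max[OF r1_0 r1_r0 dw ddw w_le]
  \<comment> \<open>At \<open>r1\<close> the penalty in \<open>G r1\<close> cancels, so
    \<open>scaled\<close> bounds \<open>m\<close> independently of \<open>e\<close>.\<close>
  have m_eq: "m = r1 powr \<alpha> * (U r1 - k * V r1)"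
    by (simp add: m_def C_def G_def)
  have "m \<ge> 0"
    using ln0[OF r1_0 r1(2)] e Gr1 by (simp add: m_def C_def)
  have "(k powr p - k) * c1 powr p \<le> K * (m + e)"
    unfolding K_def
  proof (rule touching_inequality[OF lam mu p n r1_0 refl \<alpha> \<open>m \<ge> 0\<close> _ k(3) c(1)
        lower[OF r1_0 r1(2)] _ _ _ sub[OF r1_0 r1_r0] super[OF r1_0 r1_r0]])
    show "e \<ge> 0" using e by simp
    show "U r1 = k * V r1 + r1 powr - \<alpha> * m"
      using wr1 by (simp add: w_def \<psi>_def m_def)
    show "U1 r1 = k * V1 r1 + r1 powr (- \<alpha> - 1) * (- \<alpha> * m - e)"
      using crit(1) by (simp add: \<psi>1_def m_def)
    show "U2 r1 \<le> k * V2 r1 + r1 powr (- \<alpha> - 2) * ((\<alpha> + 1) * (\<alpha> * m + e) + \<alpha> * e)"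
      using crit(2) by (simp add: \<psi>2_def)
  qed
  also have "\<dots> < \<delta>"
  proof -
    have "K * m \<le> \<delta> / 2"
      using mult_left_mono[OF scaled[OF r1_0 r1(2)], of K] k_near K unfolding m_eq by linarith
    with e show ?thesis by (simp add: distrib_left)
  qed
  finally show False using \<delta>_le by simp
qed

section \<open>Reduction of the theorem to radial profiles\<close>

theorem theorem2p3:
  fixes u v :: "real ^ 'n \<Rightarrow> real"
    and U V :: "real \<Rightarrow> real"
    and lam Lam mu p r0 c1 c2 :: real
  assumes "0 < lam" and "lam \<le> Lam"
    and "mu > 0" and "p > 1" and "r0 > 0"
    and "\<forall>x \<in> cball 0 r0 - {0}. u x = U (norm x)"
    and "\<forall>x \<in> cball 0 r0 - {0}. v x = V (norm x)"
    and "\<forall>x \<in> ball 0 r0 - {0}. u x > 0"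
    and "\<forall>x \<in> ball 0 r0 - {0}. v x > 0"
    and "C2_on (ball 0 r0 - {0}) u"
    and "C2_on (ball 0 r0 - {0}) v"
    and "\<forall>x \<in> ball 0 r0 - {0}.
           pucci_sup lam Lam (hessian u x) + mu * u x / (norm x)\<^sup>2 - u x powr p \<ge> 0"
    and "\<forall>x \<in> ball 0 r0 - {0}.
           0 \<ge> pucci_sup lam Lam (hessian v x) + mu * v x / (norm x)\<^sup>2 - v x powr p"
    and "continuous_on (cball 0 r0 - {0}) u"
    and "continuous_on (cball 0 r0 - {0}) v"
    and "c1 > 0" and "c2 > 0"
    and "\<forall>r. 0 < r \<and> r \<le> r0 \<longrightarrow> c1 * r powr (- (2 / (p - 1))) \<le> V r"
    and "\<forall>r. 0 < r \<and> r \<le> r0 \<longrightarrow>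
           U r \<le> c2 * r powr (- (2 / (p - 1))) \<and> V r \<le> c2 * r powr (- (2 / (p - 1)))"
    and "U r0 \<le> V r0"
  shows "\<forall>x \<in> cball 0 r0 - {0}. u x \<le> v x"
proof -
  \<comment> \<open>Any coordinate direction will do: its positive half-axis meets every sphere
    once.\<close>
  fix k :: 'n
  let ?a = "\<lambda>r. r *\<^sub>R axis k 1 :: real ^ 'n"
  have in_cball: "?a r \<in> cball 0 r0 - {0}" if "0 < r" "r \<le> r0" for r
    using that by (auto simp: axis_eq_0_iff)
  have in_ball: "?a r \<in> ball 0 r0 - {0}" if "0 < r" "r < r0" for r
    using that by (auto simp: axis_eq_0_iff)
  have norm_a: "norm (?a r) = r" if "0 < r" for r
    using that by simp
  have rad: "u (?a r) = U r" "v (?a r) = V r" if "0 < r" "r \<le> r0" for r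
    using assms(6,7) in_cball[OF that] norm_a[OF that(1)] by auto
  \<comment> \<open>Restriction to the half-axis carries continuity up to and including
    \<open>r0\<close> over to the profiles.\<close>
  have cont: "continuous_on {0<..r0} W"
    if "continuous_on (cball 0 r0 - {0}) w" "\<And>r. 0 < r \<Longrightarrow> r \<le> r0 \<Longrightarrow> w (?a r) = W r"
    for w :: "real ^ 'n \<Rightarrow> real" and W
  proof -
    have "continuous_on {0<..r0} (\<lambda>r. w (?a r))"
      by (rule continuous_on_compose2[OF that(1)]) (use in_cball in \<open>auto intro!: continuous_intros\<close>)
    then show ?thesis
      by (rule continuous_on_eq) (use that(2) in auto)
  qed
  obtain U1 U2 where U: "\<And>r. 0 < r \<Longrightarrow> r < r0 \<Longrightarrow> (U has_real_derivative U1 r) (at r)"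
    "\<And>r. 0 < r \<Longrightarrow> r < r0 \<Longrightarrow> (U1 has_real_derivative U2 r) (at r)"
    "\<And>r i j. 0 < r \<Longrightarrow> r < r0 \<Longrightarrow> hessian u (?a r) $ i $ j
       = (if i \<noteq> j then 0 else if i = k then U2 r else U1 r / r)"
    using radial_C2[OF assms(10), of U k] assms(6) by auto
  obtain V1 V2 where V: "\<And>r. 0 < r \<Longrightarrow> r < r0 \<Longrightarrow> (V has_real_derivative V1 r) (at r)"
    "\<And>r. 0 < r \<Longrightarrow> r < r0 \<Longrightarrow> (V1 has_real_derivative V2 r) (at r)"
    "\<And>r i j. 0 < r \<Longrightarrow> r < r0 \<Longrightarrow> hessian v (?a r) $ i $ j
       = (if i \<noteq> j then 0 else if i = k then V2 r else V1 r / r)"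
    using radial_C2[OF assms(11), of V k] assms(7) by auto
  have "U r \<le> V r" if r: "0 < r" "r \<le> r0" for r
  proof (rule radial_comparison[OF assms(1-5) _ refl U(1,2) V(1,2) _ _ _ _ assms(16,17) _ _ _ assms(20) r])
    \<comment> \<open>The \<open>n\<close> of the radial inequality counts the directions orthogonal
      to the axis; it is 0 in dimension one.\<close>
    show "pucci_scalar lam Lam (U2 r) + real (CARD('n) - 1) * pucci_scalar lam Lam (U1 r / r)
        + mu * U r / r\<^sup>2 - U r powr p \<ge> 0" if "0 < r" "r < r0" for r
      using bspec[OF assms(12) in_ball[OF that]] pucci_sup_hessian_radial[OF assms(2) U(3)[OF that]]
        rad(1)[of r] norm_a[of r] that by auto
    show "0 \<ge> pucci_scalar lam Lam (V2 r) + real (CARD('n) - 1) * pucci_scalar lam Lam (V1 r / r)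
        + mu * V r / r\<^sup>2 - V r powr p" if "0 < r" "r < r0" for r
      using bspec[OF assms(13) in_ball[OF that]] pucci_sup_hessian_radial[OF assms(2) V(3)[OF that]]
        rad(2)[of r] norm_a[of r] that by auto
    show "continuous_on {0<..r0} U" by (rule cont[OF assms(14)]) (rule rad)
    show "continuous_on {0<..r0} V" by (rule cont[OF assms(15)]) (rule rad)
  qed (use assms(18,19) in auto)
  then show ?thesis using assms(6,7) by auto
qed

end
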